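(* Let $Q$ be a set with a fixed element $e\in Q$. Then the mappings $$\mathcal E: (Q,\cdot)\mapsto (\mathrm{RMlt}(Q,\cdot),R_e),$$ $$\mathcal Q: (G,\zeta)\mapsto (Q,\circ),\quad x\circ y = x^{\zeta^{\widehat y}},$$ where $\widehat y$ denotes any element of $G$ satisfying $e^{\widehat y}=y$, are mutually inverse bijections between the set of connected quandles on $Q$ (i.e. binary operations on $Q$ making $Q$ a connected quandle) and the set of quandle envelopes on $Q$ (with respect to $e$).
   Context: Mappings are applied on the right, as superscripts: $x^{\alpha\beta}=(x^\alpha)^\beta$; for group elements $\alpha^\beta=\beta^{-1}\alpha\beta$. A quandle is a set $Q$ with a binary operation $\cdot$ such that for every $x\in Q$ the right translation $R_x:Q\to Q$, $y\mapsto y\cdot x$, is an automorphism of $(Q,\cdot)$, and $x\cdot x=x$ for all $x\in Q$. The right multiplication group is $\mathrm{RMlt}(Q,\cdot)=\langle R_x : x\in Q\rangle\le \mathrm{Aut}(Q,\cdot)$. A quandle is connected if $\mathrm{RMlt}(Q,\cdot)$ acts transitively on $Q$. A quandle envelope on $Q$ (with respect to $e$) is a pair $(G,\zeta)$ where $G$ is a transitive permutation group on $Q$, $\zeta\in Z(G_e)$ (the center of the stabilizer $G_e$ of $e$ in $G$), and $\langle \zeta^G\rangle=G$, i.e. the smallest normal subgroup of $G$ containing $\zeta$ is $G$. For such a pair, $\zeta^{\widehat y}$ does not depend on the choice of $\widehat y\in G$ with $e^{\widehat y}=y$. *)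

theory Defs
  imports "HOL-Algebra.Algebra"
begin

text \<open>A binary operation on the set \<open>Q\<close> is a curried function in
  \<open>Q \<rightarrow>\<^sub>E Q \<rightarrow>\<^sub>E Q\<close>; extensionality makes HOL equality of such functions
  coincide with equality of operations on \<open>Q\<close>. Likewise a permutation of \<open>Q\<close>
  is an element of \<open>Bij Q\<close>, which is extensional.\<close>

definition right_translation :: "'a set \<Rightarrow> ('a \<Rightarrow> 'a \<Rightarrow> 'a) \<Rightarrow> 'a \<Rightarrow> 'a \<Rightarrow> 'a" where
  "right_translation Q m x = (\<lambda>y\<in>Q. m y x)"

definition quandle_aut :: "'a set \<Rightarrow> ('a \<Rightarrow> 'a \<Rightarrow> 'a) \<Rightarrow> ('a \<Rightarrow> 'a) set" where
  "quandle_aut Q m = {f \<in> Bij Q. \<forall>x\<in>Q. \<forall>y\<in>Q. f (m x y) = m (f x) (f y)}"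

definition quandle :: "'a set \<Rightarrow> ('a \<Rightarrow> 'a \<Rightarrow> 'a) \<Rightarrow> bool" where
  "quandle Q m \<longleftrightarrow>
     m \<in> Q \<rightarrow>\<^sub>E Q \<rightarrow>\<^sub>E Q \<and>
     (\<forall>x\<in>Q. right_translation Q m x \<in> quandle_aut Q m) \<and>
     (\<forall>x\<in>Q. m x x = x)"

text \<open>The library composes permutations as functions: \<open>g \<otimes> f\<close> in \<open>BijGroup Q\<close> is
  \<open>f\<close> followed by \<open>g\<close>. With mappings written on the right this product is \<open>f g\<close>, so the
  group used here is the opposite of that of the right-action convention.
  Subgroups, generation, stabilizers, centers and normal subgroups agree for both
  products; only the formula for conjugation has to be transcribed.\<close>

abbreviation perm_group :: "'a set \<Rightarrow> ('a \<Rightarrow> 'a) set \<Rightarrow> ('a \<Rightarrow> 'a) monoid" where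
  "perm_group Q G \<equiv> (BijGroup Q)\<lparr>carrier := G\<rparr>"

definition transitive_perm_group :: "'a set \<Rightarrow> ('a \<Rightarrow> 'a) set \<Rightarrow> bool" where
  "transitive_perm_group Q G \<longleftrightarrow>
     subgroup G (BijGroup Q) \<and> transitive_action (perm_group Q G) Q (\<lambda>g. g)"

definition RMlt :: "'a set \<Rightarrow> ('a \<Rightarrow> 'a \<Rightarrow> 'a) \<Rightarrow> ('a \<Rightarrow> 'a) set" where
  "RMlt Q m = generate (BijGroup Q) (right_translation Q m ` Q)"

definition connected_quandles :: "'a set \<Rightarrow> ('a \<Rightarrow> 'a \<Rightarrow> 'a) set" where
  "connected_quandles Q = {m. quandle Q m \<and> transitive_perm_group Q (RMlt Q m)}"

definition group_center :: "('g, 'b) monoid_scheme \<Rightarrow> 'g set" where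
  "group_center H = {z \<in> carrier H. \<forall>g\<in>carrier H. z \<otimes>\<^bsub>H\<^esub> g = g \<otimes>\<^bsub>H\<^esub> z}"

text \<open>The conjugate \<open>a\<^sup>b\<close>, which in the right-action convention reads \<open>b\<inverse> a b\<close>
  (apply \<open>b\<inverse>\<close> first, then \<open>a\<close>, then \<open>b\<close>), transcribed to the library's product.\<close>

definition conj_by :: "('g, 'b) monoid_scheme \<Rightarrow> 'g \<Rightarrow> 'g \<Rightarrow> 'g" where
  "conj_by H a b = b \<otimes>\<^bsub>H\<^esub> a \<otimes>\<^bsub>H\<^esub> inv\<^bsub>H\<^esub> b"

definition normal_closure :: "('g, 'b) monoid_scheme \<Rightarrow> 'g \<Rightarrow> 'g set" where
  "normal_closure H a = generate H (conj_by H a ` carrier H)"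

lemma normal_closure_eq_least_normal_subgroup:
  assumes "group H" and a: "a \<in> carrier H"
  shows "normal_closure H a = \<Inter>{N. N \<lhd> H \<and> a \<in> N}"
proof
  interpret group H by fact
  let ?C = "conj_by H a ` carrier H"
  have C: "?C \<subseteq> carrier H"
    using a by (auto simp: conj_by_def)
  show "normal_closure H a \<subseteq> \<Inter>{N. N \<lhd> H \<and> a \<in> N}"
  proof (intro Inter_greatest)
    fix N assume "N \<in> {N. N \<lhd> H \<and> a \<in> N}"
    then have N: "N \<lhd> H" "a \<in> N" by auto
    then have "?C \<subseteq> N"
      by (auto simp: conj_by_def normal_inv_iff)
    then show "normal_closure H a \<subseteq> N"
      unfolding normal_closure_def
      using N(1) by (intro generate_subgroup_incl normal_imp_subgroup)
  qed
  have "a = conj_by H a \<one>\<^bsub>H\<^esub>"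
    using a by (simp add: conj_by_def)
  then have "a \<in> normal_closure H a"
    unfolding normal_closure_def by (auto intro!: generate.incl)
  moreover have "normal_closure H a \<lhd> H"
    unfolding normal_closure_def
  proof (rule normal_generateI[OF C])
    fix h g assume "h \<in> ?C" and g: "g \<in> carrier H"
    then obtain b where b: "b \<in> carrier H" "h = conj_by H a b" by auto
    then have "g \<otimes>\<^bsub>H\<^esub> h \<otimes>\<^bsub>H\<^esub> inv\<^bsub>H\<^esub> g = conj_by H a (g \<otimes>\<^bsub>H\<^esub> b)"
      using a g by (simp add: conj_by_def m_assoc inv_mult_group)
    then show "g \<otimes>\<^bsub>H\<^esub> h \<otimes>\<^bsub>H\<^esub> inv\<^bsub>H\<^esub> g \<in> ?C"
      using b g by auto
  qed
  ultimately show "\<Inter>{N. N \<lhd> H \<and> a \<in> N} \<subseteq> normal_closure H a"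
    by auto
qed

definition quandle_envelopes :: "'a set \<Rightarrow> 'a \<Rightarrow> (('a \<Rightarrow> 'a) set \<times> ('a \<Rightarrow> 'a)) set" where
  "quandle_envelopes Q e =
     {(G, \<zeta>). transitive_perm_group Q G \<and>
        \<zeta> \<in> group_center (perm_group Q (stabilizer (perm_group Q G) (\<lambda>g. g) e)) \<and>
        normal_closure (perm_group Q G) \<zeta> = G}"

definition quandle_to_envelope ::
    "'a set \<Rightarrow> 'a \<Rightarrow> ('a \<Rightarrow> 'a \<Rightarrow> 'a) \<Rightarrow> ('a \<Rightarrow> 'a) set \<times> ('a \<Rightarrow> 'a)" where
  "quandle_to_envelope Q e m = (RMlt Q m, right_translation Q m e)"

definition envelope_to_quandle ::
    "'a set \<Rightarrow> 'a \<Rightarrow> ('a \<Rightarrow> 'a) set \<times> ('a \<Rightarrow> 'a) \<Rightarrow> 'a \<Rightarrow> 'a \<Rightarrow> 'a" where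
  "envelope_to_quandle Q e = (\<lambda>(G, \<zeta>). \<lambda>x\<in>Q. \<lambda>y\<in>Q.
     conj_by (perm_group Q G) \<zeta> (SOME g. g \<in> G \<and> g e = y) x)"

end

theory Submission
  imports Defs
begin

text \<open>Everything rests on the identity \<open>f R\<^sub>y f\<inverse> = R\<^bsub>f y\<^esub>\<close>, which for a
  permutation \<open>f\<close> of \<open>Q\<close> expresses exactly that \<open>f\<close> is an automorphism. In a connected quandle it
  shows that \<open>R\<^sub>e\<close> commutes with the stabilizer of \<open>e\<close> and that the conjugates of \<open>R\<^sub>e\<close> are
  precisely the right translations. Conversely, for an envelope \<open>(G, \<zeta>)\<close> the conjugate of \<open>\<zeta>\<close>
  by \<open>g\<close> depends only on \<open>g e\<close>; taking it as the right translation by \<open>g e\<close> makes the identity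
  hold for all \<open>f \<in> G\<close>, so \<open>G\<close> acts by automorphisms, and \<open>G\<close> is generated by the translations.\<close>

section \<open>Conjugation in a group and in its subgroups\<close>

lemma (in group) conj_by_closed [simp]:
  "\<lbrakk>a \<in> carrier G; b \<in> carrier G\<rbrakk> \<Longrightarrow> conj_by G a b \<in> carrier G"
  by (simp add: conj_by_def)

text \<open>With \<open>b \<otimes> a \<otimes> inv b\<close> as the conjugate, conjugation is a
  left action, hence the order \<open>c \<otimes> b\<close>.\<close>

lemma (in group) conj_by_conj_by:
  "\<lbrakk>a \<in> carrier G; b \<in> carrier G; c \<in> carrier G\<rbrakk> \<Longrightarrow>
     conj_by G (conj_by G a b) c = conj_by G a (c \<otimes> b)"
  by (simp add: conj_by_def inv_mult_group m_assoc)

lemma (in group) conj_by_one: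
  "a \<in> carrier G \<Longrightarrow> conj_by G a \<one> = a"
  by (simp add: conj_by_def)

lemma (in group) conj_by_eq_iff:
  assumes "a \<in> carrier G" "b \<in> carrier G" "c \<in> carrier G"
  shows "conj_by G a b = c \<longleftrightarrow> b \<otimes> a = c \<otimes> b"
  unfolding conj_by_def using assms by (metis inv_solve_right m_closed)

lemma (in group) conj_by_subgroup:
  "\<lbrakk>subgroup H G; b \<in> H\<rbrakk> \<Longrightarrow> conj_by (G\<lparr>carrier := H\<rparr>) a b = conj_by G a b"
  by (simp add: conj_by_def)

lemma (in subgroup) conj_by_mem:
  "\<lbrakk>a \<in> H; b \<in> H\<rbrakk> \<Longrightarrow> conj_by G a b \<in> H"
  by (simp add: conj_by_def)

text \<open>Products, inverses and generated subgroups of \<open>H\<close> agree with those of the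
  ambient group, so the normal closure can be computed there, conjugating by elements of
  \<open>H\<close> only.\<close>

lemma (in group) normal_closure_subgroup:
  assumes "subgroup H G" "a \<in> H"
  shows "normal_closure (G\<lparr>carrier := H\<rparr>) a = generate G (conj_by G a ` H)"
proof -
  have "conj_by (G\<lparr>carrier := H\<rparr>) a ` H = conj_by G a ` H"
    using assms(1) by (intro image_cong) (auto simp: conj_by_subgroup)
  moreover have "conj_by G a ` H \<subseteq> H"
    using assms subgroup.conj_by_mem by fastforce
  ultimately show ?thesis
    using assms(1) by (simp add: normal_closure_def generate_consistent)
qed

section \<open>Permutations and transitivity\<close>

lemma carrier_BijGroup [simp]: "carrier (BijGroup Q) = Bij Q"
  by (simp add: BijGroup_def)

lemma mult_BijGroup_apply [simp]:
  "\<lbrakk>f \<in> Bij Q; g \<in> Bij Q; x \<in> Q\<rbrakk> \<Longrightarrow> (f \<otimes>\<^bsub>BijGroup Q\<^esub> g) x = f (g x)"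
  by (simp add: BijGroup_def compose_eq)

lemma one_BijGroup_apply [simp]: "x \<in> Q \<Longrightarrow> \<one>\<^bsub>BijGroup Q\<^esub> x = x"
  by (simp add: BijGroup_def)

lemma Bij_apply_mem: "\<lbrakk>f \<in> Bij Q; x \<in> Q\<rbrakk> \<Longrightarrow> f x \<in> Q"
  using Bij_imp_funcset by fastforce

lemma Bij_eqI:
  "\<lbrakk>f \<in> Bij Q; g \<in> Bij Q; \<And>x. x \<in> Q \<Longrightarrow> f x = g x\<rbrakk> \<Longrightarrow> f = g"
  by (meson Bij_imp_extensional extensionalityI)

lemma inv_BijGroup_apply_eq:
  assumes "f \<in> Bij Q" "x \<in> Q" "f x = y"
  shows "(inv\<^bsub>BijGroup Q\<^esub> f) y = x"
  using assms Bij_apply_mem[OF assms(1,2)]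
  by (auto simp: inv_BijGroup Bij_def bij_betw_def)

text \<open>For a subgroup of \<open>BijGroup Q\<close> the inclusion is a homomorphism, so the
  action axioms hold automatically and only transitivity remains.\<close>

lemma transitive_perm_group_iff:
  "transitive_perm_group Q G \<longleftrightarrow>
     subgroup G (BijGroup Q) \<and> (\<forall>x\<in>Q. \<forall>y\<in>Q. \<exists>g\<in>G. g x = y)"
proof -
  interpret B: group "BijGroup Q" by (rule group_BijGroup)
  have "group_action (perm_group Q G) Q (\<lambda>g. g)" if "subgroup G (BijGroup Q)"
    using that subgroup.subset[OF that]
    by (auto simp: group_action_def group_hom_def group_hom_axioms_def hom_def
        group_BijGroup B.subgroup_imp_group)
  then show ?thesis
    by (auto simp: transitive_perm_group_def transitive_action_def transitive_action_axioms_def)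
qed

lemma transitive_image_eq:
  assumes "transitive_perm_group Q G" "e \<in> Q"
  shows "(\<lambda>g. g e) ` G = Q"
proof
  show "(\<lambda>g. g e) ` G \<subseteq> Q"
    using assms subgroup.subset[of G "BijGroup Q"]
    by (auto simp: transitive_perm_group_iff Bij_apply_mem subset_iff)
  show "Q \<subseteq> (\<lambda>g. g e) ` G"
    using assms by (force simp: transitive_perm_group_iff)
qed

section \<open>Envelopes and the conjugates of \<zeta>\<close>

text \<open>Working form of the definition: stabilizer and center are unfolded, and all operations
  take place in the single group \<open>BijGroup Q\<close>.\<close>

lemma quandle_envelopes_iff:
  "(G, \<zeta>) \<in> quandle_envelopes Q e \<longleftrightarrow>
     subgroup G (BijGroup Q) \<and> (\<forall>x\<in>Q. \<forall>y\<in>Q. \<exists>g\<in>G. g x = y) \<and>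
     \<zeta> \<in> G \<and> \<zeta> e = e \<and> (\<forall>g\<in>G. g e = e \<longrightarrow> \<zeta> \<otimes>\<^bsub>BijGroup Q\<^esub> g = g \<otimes>\<^bsub>BijGroup Q\<^esub> \<zeta>) \<and>
     generate (BijGroup Q) (conj_by (BijGroup Q) \<zeta> ` G) = G"
  using group.normal_closure_subgroup[OF group_BijGroup, of G Q \<zeta>]
  by (auto simp: quandle_envelopes_def transitive_perm_group_iff group_center_def stabilizer_def)

text \<open>The quotient \<open>?k\<close> of \<open>g\<close> by \<open>h\<close> fixes
  \<open>e\<close>, so it commutes with \<zeta>, which is central in the stabilizer. Conjugating by
  \<open>g\<close>, the product of \<open>h\<close> and \<open>?k\<close>, is therefore the same as
  conjugating by \<open>h\<close>.\<close>

lemma envelope_conj_by_cong: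
  assumes G: "(G, \<zeta>) \<in> quandle_envelopes Q e" and e: "e \<in> Q"
    and g: "g \<in> G" and h: "h \<in> G" and eq: "g e = h e"
  shows "conj_by (BijGroup Q) \<zeta> g = conj_by (BijGroup Q) \<zeta> h"
proof -
  interpret B: group "BijGroup Q" by (rule group_BijGroup)
  interpret G: subgroup G "BijGroup Q" using G by (simp add: quandle_envelopes_iff)
  let ?k = "inv\<^bsub>BijGroup Q\<^esub> h \<otimes>\<^bsub>BijGroup Q\<^esub> g"
  have k: "?k \<in> G" using g h by simp
  have mem: "g \<in> Bij Q" "h \<in> Bij Q" "\<zeta> \<in> Bij Q" "inv\<^bsub>BijGroup Q\<^esub> h \<in> Bij Q" "?k \<in> Bij Q"
    using G G.subset g h k by (auto simp: quandle_envelopes_iff)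
  have "?k e = e"
    using mem e eq by (simp add: inv_BijGroup_apply_eq)
  then have "?k \<otimes>\<^bsub>BijGroup Q\<^esub> \<zeta> = \<zeta> \<otimes>\<^bsub>BijGroup Q\<^esub> ?k"
    using G k by (simp add: quandle_envelopes_iff)
  then have "conj_by (BijGroup Q) \<zeta> ?k = \<zeta>"
    using mem by (simp add: B.conj_by_eq_iff)
  moreover have "g = h \<otimes>\<^bsub>BijGroup Q\<^esub> ?k"
    using mem by (simp add: B.m_assoc[symmetric])
  ultimately show ?thesis
    using mem by (metis B.conj_by_conj_by carrier_BijGroup)
qed

lemma envelope_to_quandle_apply:
  assumes G: "(G, \<zeta>) \<in> quandle_envelopes Q e" and e: "e \<in> Q"
    and x: "x \<in> Q" and y: "y \<in> Q" and g: "g \<in> G" "g e = y"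
  shows "envelope_to_quandle Q e (G, \<zeta>) x y = conj_by (BijGroup Q) \<zeta> g x"
proof -
  interpret B: group "BijGroup Q" by (rule group_BijGroup)
  define h where "h = (SOME g. g \<in> G \<and> g e = y)"
  have h: "h \<in> G" "h e = y"
    unfolding h_def using someI[of "\<lambda>g. g \<in> G \<and> g e = y"] g by blast+
  have "envelope_to_quandle Q e (G, \<zeta>) x y = conj_by (perm_group Q G) \<zeta> h x"
    using x y by (simp add: envelope_to_quandle_def h_def)
  also have "\<dots> = conj_by (BijGroup Q) \<zeta> h x"
    using G h by (simp add: quandle_envelopes_iff B.conj_by_subgroup)
  also have "\<dots> = conj_by (BijGroup Q) \<zeta> g x"
    using envelope_conj_by_cong[OF G e h(1) g(1)] h(2) g(2) by simp
  finally show ?thesis .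
qed

lemma envelope_right_translation:
  assumes G: "(G, \<zeta>) \<in> quandle_envelopes Q e" and e: "e \<in> Q" and g: "g \<in> G"
  shows "right_translation Q (envelope_to_quandle Q e (G, \<zeta>)) (g e) = conj_by (BijGroup Q) \<zeta> g"
proof -
  interpret B: group "BijGroup Q" by (rule group_BijGroup)
  have mem: "g \<in> Bij Q" "\<zeta> \<in> Bij Q"
    using G g subgroup.subset[of G "BijGroup Q"] by (auto simp: quandle_envelopes_iff)
  then have "conj_by (BijGroup Q) \<zeta> g \<in> extensional Q"
    using B.conj_by_closed[of \<zeta> g] by (simp add: Bij_imp_extensional)
  then show ?thesis
    using mem e g
    by (intro extensionalityI[of _ Q])
      (auto simp: right_translation_def envelope_to_quandle_apply[OF G e] Bij_apply_mem)
qed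

section \<open>Automorphisms and the right multiplication group\<close>

text \<open>Multiplying the conjugation identity by \<open>f\<close> on the right and evaluating at
  \<open>x\<close> gives the homomorphism law for the pair \<open>x\<close>,
  \<open>y\<close>.\<close>

lemma quandle_aut_iff:
  assumes "\<And>y. y \<in> Q \<Longrightarrow> right_translation Q m y \<in> Bij Q" and f: "f \<in> Bij Q"
  shows "f \<in> quandle_aut Q m \<longleftrightarrow>
     (\<forall>y\<in>Q. conj_by (BijGroup Q) (right_translation Q m y) f = right_translation Q m (f y))"
proof -
  interpret B: group "BijGroup Q" by (rule group_BijGroup)
  have "conj_by (BijGroup Q) (right_translation Q m y) f = right_translation Q m (f y) \<longleftrightarrow>
      (\<forall>x\<in>Q. f (m x y) = m (f x) (f y))" (is "?L \<longleftrightarrow> ?R") if y: "y \<in> Q" for y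
  proof -
    let ?Ry = "right_translation Q m y" and ?Rfy = "right_translation Q m (f y)"
    have R: "?Ry \<in> Bij Q" "?Rfy \<in> Bij Q"
      using assms y by (auto simp: Bij_apply_mem)
    have apply_Ry: "?Ry x = m x y" if "x \<in> Q" for x
      using that by (simp add: right_translation_def)
    have apply_Rfy: "?Rfy (f x) = m (f x) (f y)" if "x \<in> Q" for x
      using that f by (simp add: right_translation_def Bij_apply_mem)
    have "?L \<longleftrightarrow> f \<otimes>\<^bsub>BijGroup Q\<^esub> ?Ry = ?Rfy \<otimes>\<^bsub>BijGroup Q\<^esub> f"
      using R f by (simp add: B.conj_by_eq_iff)
    also have "\<dots> \<longleftrightarrow> (\<forall>x\<in>Q. (f \<otimes>\<^bsub>BijGroup Q\<^esub> ?Ry) x = (?Rfy \<otimes>\<^bsub>BijGroup Q\<^esub> f) x)"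
      using R f B.m_closed by (metis Bij_eqI carrier_BijGroup)
    also have "\<dots> \<longleftrightarrow> ?R"
      using R f by (simp add: apply_Ry apply_Rfy)
    finally show ?thesis .
  qed
  then show ?thesis
    using f unfolding quandle_aut_def by blast
qed

lemma subgroup_quandle_aut:
  assumes m: "m \<in> Q \<rightarrow>\<^sub>E Q \<rightarrow>\<^sub>E Q"
  shows "subgroup (quandle_aut Q m) (BijGroup Q)"
proof
  interpret B: group "BijGroup Q" by (rule group_BijGroup)
  have m_mem: "m x y \<in> Q" if "x \<in> Q" "y \<in> Q" for x y
    using m that by (auto simp: PiE_iff)
  show "quandle_aut Q m \<subseteq> carrier (BijGroup Q)"
    by (auto simp: quandle_aut_def)
  show "\<one>\<^bsub>BijGroup Q\<^esub> \<in> quandle_aut Q m"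
    using B.one_closed m_mem by (simp add: quandle_aut_def)
  show "f \<otimes>\<^bsub>BijGroup Q\<^esub> g \<in> quandle_aut Q m"
    if "f \<in> quandle_aut Q m" "g \<in> quandle_aut Q m" for f g
    using that B.m_closed[of f g] m_mem by (simp add: quandle_aut_def Bij_apply_mem)
  \<comment> \<open>The group inverse is \<open>inv_into Q f\<close> restricted to \<open>Q\<close>,
    and the inverse of a bijection respecting \<open>m\<close> respects \<open>m\<close>.\<close>
  show "inv\<^bsub>BijGroup Q\<^esub> f \<in> quandle_aut Q m" if "f \<in> quandle_aut Q m" for f
    using that m_mem B.inv_closed[of f] m
      Bij_inv_into_lemma[of Q f m] by (auto simp: quandle_aut_def inv_BijGroup PiE_iff)
qed

text \<open>The generators of \<open>RMlt Q m\<close> are automorphisms by the quandle axioms, and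
  the automorphisms form a subgroup.\<close>

lemma
  assumes "quandle Q m"
  shows RMlt_subset_quandle_aut: "RMlt Q m \<subseteq> quandle_aut Q m"
    and subgroup_RMlt: "subgroup (RMlt Q m) (BijGroup Q)"
proof -
  interpret B: group "BijGroup Q" by (rule group_BijGroup)
  have R: "right_translation Q m ` Q \<subseteq> quandle_aut Q m"
    using assms by (auto simp: quandle_def)
  show "RMlt Q m \<subseteq> quandle_aut Q m"
    unfolding RMlt_def using assms R
    by (intro B.generate_subgroup_incl subgroup_quandle_aut) (auto simp: quandle_def)
  show "subgroup (RMlt Q m) (BijGroup Q)"
    unfolding RMlt_def using R by (intro B.generate_is_subgroup) (auto simp: quandle_aut_def)
qed

lemma conj_by_right_translation:
  assumes "quandle Q m" "f \<in> RMlt Q m" "y \<in> Q"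
  shows "conj_by (BijGroup Q) (right_translation Q m y) f = right_translation Q m (f y)"
proof -
  have "f \<in> quandle_aut Q m"
    using assms RMlt_subset_quandle_aut by blast
  moreover have "right_translation Q m y \<in> Bij Q" if "y \<in> Q" for y
    using assms(1) that by (simp add: quandle_def quandle_aut_def)
  ultimately show ?thesis
    using assms(3) quandle_aut_iff[of Q m f] by (simp add: quandle_aut_def)
qed

section \<open>From connected quandles to envelopes and back\<close>

text \<open>Idempotence makes \<open>?R e\<close> fix \<open>e\<close>. Its conjugate by
  \<open>g\<close> is \<open>?R (g e)\<close>: for \<open>g e = e\<close> this gives centrality, and
  by transitivity the conjugates exhaust the right translations, which generate
  \<open>RMlt Q m\<close>.\<close>

lemma quandle_to_envelope_mem:
  assumes e: "e \<in> Q" and m: "m \<in> connected_quandles Q"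
  shows "quandle_to_envelope Q e m \<in> quandle_envelopes Q e"
proof -
  interpret B: group "BijGroup Q" by (rule group_BijGroup)
  let ?R = "right_translation Q m"
  have q: "quandle Q m" and trans: "\<forall>x\<in>Q. \<forall>y\<in>Q. \<exists>g\<in>RMlt Q m. g x = y"
    using m by (auto simp: connected_quandles_def transitive_perm_group_iff)
  note sub = subgroup_RMlt[OF q]
  have Re: "?R e \<in> RMlt Q m"
    unfolding RMlt_def using e by (auto intro: generate.incl)
  have "?R e e = e"
    using q e by (simp add: right_translation_def quandle_def)
  moreover have "?R e \<otimes>\<^bsub>BijGroup Q\<^esub> g = g \<otimes>\<^bsub>BijGroup Q\<^esub> ?R e" if "g \<in> RMlt Q m" "g e = e" for g
    using conj_by_right_translation[OF q that(1) e] that Re subgroup.subset[OF sub]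
    by (metis B.conj_by_eq_iff subsetD)
  moreover have "conj_by (BijGroup Q) (?R e) ` RMlt Q m = ?R ` Q"
  proof -
    have "conj_by (BijGroup Q) (?R e) ` RMlt Q m = ?R ` ((\<lambda>g. g e) ` RMlt Q m)"
      using conj_by_right_translation[OF q _ e] by (simp add: image_image)
    also have "(\<lambda>g. g e) ` RMlt Q m = Q"
      using m e by (simp add: connected_quandles_def transitive_image_eq)
    finally show ?thesis .
  qed
  ultimately show ?thesis
    unfolding quandle_to_envelope_def quandle_envelopes_iff
    using sub trans Re by (simp add: RMlt_def)
qed

lemma envelope_to_quandle_to_envelope:
  assumes e: "e \<in> Q" and m: "m \<in> connected_quandles Q"
  shows "envelope_to_quandle Q e (quandle_to_envelope Q e m) = m"
proof -
  have q: "quandle Q m" and trans: "\<forall>x\<in>Q. \<forall>y\<in>Q. \<exists>g\<in>RMlt Q m. g x = y"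
    using m by (auto simp: connected_quandles_def transitive_perm_group_iff)
  let ?n = "envelope_to_quandle Q e (quandle_to_envelope Q e m)"
  have env: "(RMlt Q m, right_translation Q m e) \<in> quandle_envelopes Q e"
    using quandle_to_envelope_mem[OF e m] by (simp add: quandle_to_envelope_def)
  have eq: "?n x y = m x y" if "x \<in> Q" "y \<in> Q" for x y
  proof -
    obtain g where g: "g \<in> RMlt Q m" "g e = y"
      using trans e \<open>y \<in> Q\<close> by blast
    have "?n x y = conj_by (BijGroup Q) (right_translation Q m e) g x"
      using envelope_to_quandle_apply[OF env e that g] by (simp add: quandle_to_envelope_def)
    also have "\<dots> = m x y"
      using conj_by_right_translation[OF q g(1) e] g(2) that by (simp add: right_translation_def)
    finally show ?thesis .
  qed
  \<comment> \<open>Agreement on \<open>Q\<close> yields equality of curried functions only by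
    applying extensionality twice, once for each argument.\<close>
  have "?n x = m x" if "x \<in> Q" for x
  proof (rule extensionalityI[of _ Q])
    show "?n x \<in> extensional Q"
      using that by (simp add: envelope_to_quandle_def quandle_to_envelope_def)
    show "m x \<in> extensional Q"
      using q that by (auto simp: quandle_def PiE_iff)
  qed (use eq that in auto)
  moreover have "?n \<in> extensional Q"
    by (simp add: envelope_to_quandle_def quandle_to_envelope_def)
  moreover have "m \<in> extensional Q"
    using q by (auto simp: quandle_def PiE_iff)
  ultimately show ?thesis
    by (metis extensionalityI)
qed

section \<open>From envelopes to connected quandles and back\<close>

lemma
  assumes e: "e \<in> Q" and G: "(G, \<zeta>) \<in> quandle_envelopes Q e"
  shows envelope_to_quandle_mem: "envelope_to_quandle Q e (G, \<zeta>) \<in> connected_quandles Q"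
    and quandle_to_envelope_to_quandle:
      "quandle_to_envelope Q e (envelope_to_quandle Q e (G, \<zeta>)) = (G, \<zeta>)"
proof -
  interpret B: group "BijGroup Q" by (rule group_BijGroup)
  interpret G: subgroup G "BijGroup Q" using G by (simp add: quandle_envelopes_iff)
  let ?m = "envelope_to_quandle Q e (G, \<zeta>)"
  let ?R = "right_translation Q ?m"
  have trans: "\<exists>g\<in>G. g x = y" if "x \<in> Q" "y \<in> Q" for x y
    using G that by (simp add: quandle_envelopes_iff)
  have G_Bij: "g \<in> Bij Q" if "g \<in> G" for g
    using G.subset that by auto
  have z: "\<zeta> \<in> G" "\<zeta> \<in> Bij Q" "\<zeta> e = e"
    using G G_Bij by (auto simp: quandle_envelopes_iff)
  note R = envelope_right_translation[OF G e]
  have R_G: "?R y \<in> G" if y: "y \<in> Q" for y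
    using trans[OF e y] R G.conj_by_mem z by metis
  have R_Bij: "?R y \<in> Bij Q" if "y \<in> Q" for y
    using R_G G_Bij that by blast
  have R_idem: "?R y y = y" if y: "y \<in> Q" for y
  proof -
    obtain g where g: "g \<in> G" "g e = y" using trans[OF e y] by blast
    \<comment> \<open>The inverse of \<open>g\<close> takes \<open>y\<close> to \<open>e\<close>,
      \<zeta> fixes \<open>e\<close>, and \<open>g\<close> takes \<open>e\<close> back to
      \<open>y\<close>.\<close>
    have "g \<otimes>\<^bsub>BijGroup Q\<^esub> \<zeta> \<in> Bij Q" "inv\<^bsub>BijGroup Q\<^esub> g \<in> Bij Q"
      using g z G_Bij by auto
    then have "conj_by (BijGroup Q) \<zeta> g y = y"
      using g z G_Bij e y by (simp add: conj_by_def inv_BijGroup_apply_eq[of g Q e])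
    then show ?thesis using R[OF g(1)] g(2) by simp
  qed
  have G_aut: "f \<in> quandle_aut Q ?m" if f: "f \<in> G" for f
  proof -
    have "conj_by (BijGroup Q) (?R y) f = ?R (f y)" if y: "y \<in> Q" for y
    proof -
      obtain g where g: "g \<in> G" "g e = y" using trans[OF e y] by blast
      \<comment> \<open>Since \<open>?R y\<close> is the conjugate of \<zeta> by \<open>g\<close>, a
        further conjugation by \<open>f\<close> gives the conjugate by the product of
        \<open>f\<close> and \<open>g\<close>, which sends \<open>e\<close> to
        \<open>f y\<close>.\<close>
      have "conj_by (BijGroup Q) (?R y) f = conj_by (BijGroup Q) \<zeta> (f \<otimes>\<^bsub>BijGroup Q\<^esub> g)"
        using R[OF g(1)] g f z G_Bij by (simp add: B.conj_by_conj_by)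
      also have "\<dots> = ?R (f y)"
        using R[of "f \<otimes>\<^bsub>BijGroup Q\<^esub> g"] f g e G_Bij by simp
      finally show ?thesis .
    qed
    then show ?thesis using quandle_aut_iff[of Q ?m f] R_Bij G_Bij f by blast
  qed
  have m_R: "?m x y = ?R y x" if "x \<in> Q" for x y
    using that by (simp add: right_translation_def)
  have "?m x y \<in> Q" if "x \<in> Q" "y \<in> Q" for x y
    using that m_R R_Bij Bij_apply_mem by metis
  then have "?m \<in> Q \<rightarrow>\<^sub>E Q \<rightarrow>\<^sub>E Q"
    by (auto simp: PiE_iff envelope_to_quandle_def)
  \<comment> \<open>Each \<open>?R y\<close> lies in \<open>G\<close>, and \<open>G\<close> acts by
    automorphisms.\<close>
  then have "quandle Q ?m"
    using R_G G_aut m_R R_idem by (simp add: quandle_def)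
  moreover have RMlt: "RMlt Q ?m = G"
  proof -
    have "(\<lambda>g. g e) ` G = Q"
      using trans e G.subgroup_axioms
      by (intro transitive_image_eq) (auto simp: transitive_perm_group_iff)
    \<comment> \<open>Writing every point as \<open>g e\<close> identifies the right translations
      with the conjugates of \<zeta>, which generate \<open>G\<close> by the envelope
      condition.\<close>
    then have "?R ` Q = ?R ` ((\<lambda>g. g e) ` G)" by simp
    also have "\<dots> = conj_by (BijGroup Q) \<zeta> ` G"
      using R by (simp add: image_image)
    finally show ?thesis
      using G by (simp add: RMlt_def quandle_envelopes_iff)
  qed
  ultimately show "?m \<in> connected_quandles Q"
    using trans G.subgroup_axioms by (simp add: connected_quandles_def transitive_perm_group_iff)
  \<comment> \<open>The identity of \<open>G\<close> sends \<open>e\<close> to \<open>e\<close>, so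
    \<open>?R e\<close> is the conjugate of \<zeta> by the identity.\<close>
  have "?R e = \<zeta>"
    using R[OF G.one_closed] e z by (simp add: B.conj_by_one)
  then show "quandle_to_envelope Q e ?m = (G, \<zeta>)"
    using RMlt by (simp add: quandle_to_envelope_def)
qed

theorem theorem5p3:
  fixes Q :: "'a set" and e :: 'a
  assumes "e \<in> Q"
  shows "(\<forall>(G, \<zeta>) \<in> quandle_envelopes Q e. \<forall>x\<in>Q. \<forall>y\<in>Q. \<forall>g\<in>G. g e = y \<longrightarrow>
            envelope_to_quandle Q e (G, \<zeta>) x y = conj_by (perm_group Q G) \<zeta> g x) \<and>
         bij_betw (quandle_to_envelope Q e) (connected_quandles Q) (quandle_envelopes Q e) \<and>
         bij_betw (envelope_to_quandle Q e) (quandle_envelopes Q e) (connected_quandles Q) \<and>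
         (\<forall>m \<in> connected_quandles Q.
            envelope_to_quandle Q e (quandle_to_envelope Q e m) = m) \<and>
         (\<forall>p \<in> quandle_envelopes Q e.
            quandle_to_envelope Q e (envelope_to_quandle Q e p) = p)"
proof -
  interpret B: group "BijGroup Q" by (rule group_BijGroup)
  \<comment> \<open>Independence of the chosen representative: any \<open>g\<close> in
    \<open>G\<close> with \<open>g e = y\<close> may replace the one picked by
    \<open>SOME\<close>.\<close>
  have "envelope_to_quandle Q e (G, \<zeta>) x y = conj_by (perm_group Q G) \<zeta> g x"
    if G: "(G, \<zeta>) \<in> quandle_envelopes Q e" and "x \<in> Q" "y \<in> Q" "g \<in> G" "g e = y" for G \<zeta> x y g
    using envelope_to_quandle_apply[OF G assms] that
    by (simp add: quandle_envelopes_iff B.conj_by_subgroup)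
  moreover have maps:
    "quandle_to_envelope Q e ` connected_quandles Q \<subseteq> quandle_envelopes Q e"
    "envelope_to_quandle Q e ` quandle_envelopes Q e \<subseteq> connected_quandles Q"
    using quandle_to_envelope_mem[OF assms] envelope_to_quandle_mem[OF assms] by auto
  moreover have inverse:
    "\<forall>m \<in> connected_quandles Q. envelope_to_quandle Q e (quandle_to_envelope Q e m) = m"
    "\<forall>p \<in> quandle_envelopes Q e. quandle_to_envelope Q e (envelope_to_quandle Q e p) = p"
    using envelope_to_quandle_to_envelope[OF assms] quandle_to_envelope_to_quandle[OF assms]
    by auto
  moreover have "bij_betw (quandle_to_envelope Q e) (connected_quandles Q) (quandle_envelopes Q e)"
    by (rule bij_betw_byWitness[OF inverse maps])
  moreover have "bij_betw (envelope_to_quandle Q e) (quandle_envelopes Q e) (connected_quandles Q)"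
    by (rule bij_betw_byWitness[OF inverse(2,1) maps(2,1)])
  ultimately show ?thesis
    by blast
qed

end
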